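(* Let $d\ge 2$ and $0\le k\le d-1$ be integers, and let $G(d,k)$ be as defined in the context. (i) If $k\ge\left\lfloor\frac{d+1}{2}\right\rfloor$, then $G(d,k)=1$. (ii) If $k<\left\lfloor\frac{d+1}{2}\right\rfloor$ and $k$ is even, let $e$ be the integer with $2^{e}\le k+1<2^{e+1}$. Then $G(d,k)=2$ if $d-k+1\equiv 0 \pmod{2^{e+1}}$, and $G(d,k)=1$ otherwise. (iii) If $k<\left\lfloor\frac{d+1}{2}\right\rfloor$ and $k$ is odd, let $p_1,\dots,p_t$ be the primes $\le k+1$, and let $e_i\ge 1$ be the integers with $p_i^{e_i}\le k+1<p_i^{e_i+1}$. Then \[G(d,k)=\frac{d-k+1}{\gcd(d-k+1,\,p_1^{e_1}p_2^{e_2}\cdots p_t^{e_t})}.\]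
   Context: Binomial coefficients satisfy $\binom{a}{b}=0$ when $0\le a<b$. Let $\delta=\lfloor d/2\rfloor$ and define, for $0\le i\le\delta$ and $0\le k\le d-1$, $m_{i,k}=\binom{d+1-i}{k+1}-\binom{i}{k+1}$. Define $G(d,k)=\gcd(m_{1,k},m_{2,k},\dots,m_{\delta,k})$. *)

theory Defs
  imports "HOL-Number_Theory.Cong"
begin

definition m :: "nat \<Rightarrow> nat \<Rightarrow> nat \<Rightarrow> int" where
  "m d i k = int ((d + 1 - i) choose (k + 1)) - int (i choose (k + 1))"

definition G :: "nat \<Rightarrow> nat \<Rightarrow> int" where
  "G d k = Gcd ((\<lambda>i. m d i k) ` {1..d div 2})"

end

theory Submission
  imports Defs "HOL-Algebra.Exponent"
begin

text \<open>
  Put \<open>r = k + 1\<close> and \<open>D = d - k + 1\<close>. With \<open>y = i - k\<close> the number \<open>m d i k\<close> is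
  \<open>binom(D - y, r) - (-1)^r binom(-y, r)\<close>. Both binomials satisfy the Pascal recurrence in
  \<open>(y, r)\<close>, so taking differences shows that \<open>q\<close> divides all of these numbers if and only if \<open>q\<close>
  divides \<open>(-1)^r - 1\<close> and \<open>binom(D, j)\<close> for \<open>1 \<le> j \<le> r\<close>: modulo such a \<open>q\<close> one may replace
  \<open>D\<close> by \<open>0\<close>. The gcd of the \<open>binom(D, j)\<close> is then computed one prime at a time, the minimal
  \<open>p\<close>-adic valuation being attained where \<open>j\<close> is a power of \<open>p\<close>.
\<close>

text \<open>The binomial coefficient \<open>binom(-y, j)\<close>. For \<open>y = j = 0\<close> the truncated subtraction still
  gives the correct value \<open>1\<close>.\<close>

definition neg_choose :: "nat \<Rightarrow> nat \<Rightarrow> int" where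
  "neg_choose y j = (- 1) ^ j * int ((y + j - 1) choose j)"

section \<open>Pascal recurrences for \<open>binom(-y, j)\<close> and
  \<open>binom(D - y, j)\<close>\<close>

lemma neg_choose_0_right [simp]: "neg_choose y 0 = 1"
  by (simp add: neg_choose_def)

lemma neg_choose_0_Suc [simp]: "neg_choose 0 (Suc j) = 0"
  by (simp add: neg_choose_def)

lemma neg_choose_Suc_Suc:
  "neg_choose y (Suc j) = neg_choose (Suc y) (Suc j) + neg_choose (Suc y) j"
  by (simp add: neg_choose_def algebra_simps)

lemma choose_diff_pascal:
  assumes "y < D"
  shows "int ((D - y) choose Suc j) = int ((D - Suc y) choose Suc j) + int ((D - Suc y) choose j)"
proof -
  have "D - y = Suc (D - Suc y)" using assms by simp
  then show ?thesis by simp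
qed

section \<open>Divisibility of twisted differences of binomials\<close>

text \<open>Subtracting the instances at \<open>y - 1\<close> and \<open>y\<close> lowers the index
  by one, by Pascal. Each of the \<open>s\<close> differences uses up one value of \<open>y\<close>
  at the lower end, hence \<open>a + s \<le> y\<close>.\<close>

lemma dvd_twisted_choose_lower:
  fixes q \<sigma> :: int
  assumes "\<And>y. a \<le> y \<Longrightarrow> y < D \<Longrightarrow> q dvd int ((D - y) choose r) - \<sigma> * neg_choose y r"
    and "s \<le> r" "a + s \<le> y" "y < D"
  shows "q dvd int ((D - y) choose (r - s)) - \<sigma> * neg_choose y (r - s)"
  using assms(2-4)
proof (induction s arbitrary: y)
  case 0
  then show ?case using assms(1) by simp
next
  case (Suc s)
  obtain z where y: "y = Suc z" using Suc.prems by (cases y) auto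
  define j where "j = r - Suc s"
  have j: "r - s = Suc j" using Suc.prems by (simp add: j_def)
  have "q dvd int ((D - z) choose Suc j) - \<sigma> * neg_choose z (Suc j)"
    using Suc.IH[of z] Suc.prems y j by simp
  moreover have "q dvd int ((D - y) choose Suc j) - \<sigma> * neg_choose y (Suc j)"
    using Suc.IH[of y] Suc.prems j by simp
  ultimately have "q dvd (int ((D - z) choose Suc j) - \<sigma> * neg_choose z (Suc j))
      - (int ((D - y) choose Suc j) - \<sigma> * neg_choose y (Suc j))"
    by (rule dvd_diff)
  also have "\<dots> = int ((D - y) choose j) - \<sigma> * neg_choose y j"
    using choose_diff_pascal[of z D j] neg_choose_Suc_Suc[of z j] Suc.prems y
    by (simp add: algebra_simps)
  finally show ?case by (simp add: j_def)
qed

lemma dvd_choose_of_dvd_twisted: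
  fixes q \<sigma> :: int
  assumes hyp: "\<And>y. a \<le> y \<Longrightarrow> y < D \<Longrightarrow> q dvd int ((D - y) choose r) - \<sigma> * neg_choose y r"
    and "a + r < D"
  shows "q dvd \<sigma> - 1" and "\<And>j. 1 \<le> j \<Longrightarrow> j \<le> r \<Longrightarrow> q dvd int (D choose j)"
proof -
  \<comment> \<open>At the last point \<open>y = D - 1\<close> there is room for \<open>r\<close>
    differences, so every index down to 0 is reached.\<close>
  have low: "q dvd int (1 choose j) - \<sigma> * neg_choose (D - 1) j" if "j \<le> r" for j
    using dvd_twisted_choose_lower[of a D q r \<sigma> "r - j" "D - 1"] hyp that assms(2) by simp
  show \<sigma>: "q dvd \<sigma> - 1"
    using low[of 0] by (simp add: dvd_diff_commute)
  have low1: "q dvd int (1 choose j) - neg_choose (D - 1) j" if "j \<le> r" for j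
  proof -
    have "q dvd (int (1 choose j) - \<sigma> * neg_choose (D - 1) j) + (\<sigma> - 1) * neg_choose (D - 1) j"
      using low[OF that] \<sigma> by (intro dvd_add dvd_mult2)
    then show ?thesis by (simp add: algebra_simps)
  qed
  \<comment> \<open>With \<open>\<sigma>\<close> replaced by 1, Pascal run downwards from
    \<open>y = D - 1\<close> also reaches \<open>y < a\<close>, in particular \<open>y = 0\<close>,
    where \<open>neg_choose\<close> vanishes for positive \<open>j\<close>.\<close>
  have all: "q dvd int ((D - y) choose j) - neg_choose y j" if "j \<le> r" "y < D" for y j
    using that
  proof (induction j arbitrary: y)
    case 0
    then show ?case by simp
  next
    case (Suc j)
    have "y \<le> D - 1" using Suc.prems by simp
    then show ?case
    proof (induction y rule: inc_induct)
      case base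
      then show ?case using low1[of "Suc j"] Suc.prems by simp
    next
      case (step y)
      have "q dvd (int ((D - Suc y) choose Suc j) - neg_choose (Suc y) (Suc j))
          + (int ((D - Suc y) choose j) - neg_choose (Suc y) j)"
        using step Suc.IH[of "Suc y"] Suc.prems by (intro dvd_add) auto
      then show ?case
        using choose_diff_pascal[of y D j] neg_choose_Suc_Suc[of y j] step
        by (simp add: algebra_simps)
    qed
  qed
  show "q dvd int (D choose j)" if "1 \<le> j" "j \<le> r" for j
  proof -
    obtain j' where "j = Suc j'" using \<open>1 \<le> j\<close> by (cases j) auto
    then show ?thesis using all[of j 0] that assms(2) by simp
  qed
qed

text \<open>At \<open>y = 0\<close> this is the hypothesis; Pascal then gives index
  \<open>j + 1\<close> at \<open>y + 1\<close> from index \<open>j + 1\<close> at \<open>y\<close>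
  and index \<open>j\<close> at \<open>y + 1\<close>.\<close>

lemma dvd_choose_diff_neg_choose:
  fixes q :: int
  assumes "\<And>j. 1 \<le> j \<Longrightarrow> j \<le> r \<Longrightarrow> q dvd int (D choose j)"
    and "y \<le> D" "j \<le> r"
  shows "q dvd int ((D - y) choose j) - neg_choose y j"
  using assms(2,3)
proof (induction y arbitrary: j)
  case 0
  then show ?case using assms(1)[of j] by (cases j) auto
next
  case (Suc y)
  note IH = Suc.IH and y = Suc.prems(1)
  show ?case using Suc.prems(2)
  proof (induction j)
    case 0
    then show ?case by simp
  next
    case (Suc j)
    have "q dvd (int ((D - y) choose Suc j) - neg_choose y (Suc j))
        - (int ((D - Suc y) choose j) - neg_choose (Suc y) j)"
      by (rule dvd_diff) (use IH[of "Suc j"] Suc y in simp_all)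
    then show ?case
      using choose_diff_pascal[of y D j] neg_choose_Suc_Suc[of y j] y
      by (simp add: algebra_simps)
  qed
qed

section \<open>The common divisors of the numbers \<open>m d i k\<close>\<close>

lemma m_reflect: "i \<le> d + 1 \<Longrightarrow> m d (d + 1 - i) k = - m d i k"
  by (simp add: m_def)

lemma m_eq_twisted_choose:
  assumes "y + k \<le> d"
  shows "m d (y + k) k
    = int ((d + 1 - k - y) choose (k + 1)) - (- 1) ^ (k + 1) * neg_choose y (k + 1)"
proof -
  have "d + 1 - (y + k) = d + 1 - k - y" by simp
  moreover have "(- 1) ^ (k + 1) * neg_choose y (k + 1) = int ((y + k) choose (k + 1))"
    by (simp add: neg_choose_def mult.assoc[symmetric] power_mult_distrib[symmetric])
  ultimately show ?thesis by (simp add: m_def)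
qed

text \<open>Reflection only changes signs, and for odd \<open>d\<close> the middle index contributes
  0.\<close>

lemma dvd_G_iff_all: "q dvd G d k \<longleftrightarrow> (\<forall>i\<in>{1..d}. q dvd m d i k)"
proof -
  have "q dvd m d i k" if *: "\<forall>i\<in>{1..d div 2}. q dvd m d i k" and i: "i \<in> {1..d}" for i
  proof -
    consider "i \<le> d div 2" | "d + 1 - i \<le> d div 2" | "d + 1 - i = i"
      by linarith
    then show ?thesis
    proof cases
      case 1
      then show ?thesis using * i by simp
    next
      case 2
      then have "d + 1 - i \<in> {1..d div 2}" using i by auto
      then have "q dvd m d (d + 1 - i) k" using * by blast
      then show ?thesis using m_reflect[of i d k] i by simp
    next
      case 3
      then show ?thesis by (simp add: m_def)
    qed
  qed
  then show ?thesis by (auto simp: G_def dvd_Gcd_iff)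
qed

proposition dvd_G_iff:
  fixes q :: int
  assumes "d \<ge> 2" and "k < (d + 1) div 2"
  shows "q dvd G d k \<longleftrightarrow>
    q dvd (- 1) ^ (k + 1) - 1 \<and> (\<forall>j\<in>{1..k + 1}. q dvd int ((d + 1 - k) choose j))"
    (is "?L \<longleftrightarrow> ?S \<and> ?C")
proof
  assume ?L
  \<comment> \<open>The index \<open>y + k\<close> must be at least 1, which excludes
    \<open>y = 0\<close> when \<open>k = 0\<close>.\<close>
  define a :: nat where "a = (if k = 0 then 1 else 0)"
  have hyp: "q dvd int ((d + 1 - k - y) choose (k + 1)) - (- 1) ^ (k + 1) * neg_choose y (k + 1)"
    if "a \<le> y" "y < d + 1 - k" for y
  proof -
    have y: "y + k \<in> {1..d}" using that by (auto simp: a_def split: if_splits)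
    then have "q dvd m d (y + k) k" using \<open>?L\<close> unfolding dvd_G_iff_all by blast
    then show ?thesis using m_eq_twisted_choose[of y k d] y by (simp only: atLeastAtMost_iff)
  qed
  \<comment> \<open>For \<open>k = 0\<close> this is \<open>2 < d + 1\<close>, hence
    \<open>d \<ge> 2\<close>; otherwise it is \<open>2 * k < d\<close>.\<close>
  have "a + (k + 1) < d + 1 - k" using assms by (auto simp: a_def)
  from dvd_choose_of_dvd_twisted[OF hyp this] show "?S \<and> ?C" by auto
next
  assume SC: "?S \<and> ?C"
  have upper: "q dvd m d i k" if "k \<le> i" "i \<le> d" for i
  proof -
    define y where "y = i - k"
    have y: "i = y + k" "y + k \<le> d" using that by (auto simp: y_def)
    have "q dvd int ((d + 1 - k - y) choose (k + 1)) - neg_choose y (k + 1)"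
      using SC y by (intro dvd_choose_diff_neg_choose[where r = "k + 1"]) auto
    moreover have "q dvd ((- 1) ^ (k + 1) - 1) * neg_choose y (k + 1)"
      using SC by (intro dvd_mult2) auto
    ultimately have "q dvd (int ((d + 1 - k - y) choose (k + 1)) - neg_choose y (k + 1))
        - ((- 1) ^ (k + 1) - 1) * neg_choose y (k + 1)"
      by (rule dvd_diff)
    then show ?thesis
      using m_eq_twisted_choose[OF y(2)] y(1) by (simp add: algebra_simps)
  qed
  show ?L unfolding dvd_G_iff_all
  proof
    fix i assume i: "i \<in> {1..d}"
    show "q dvd m d i k"
    proof (cases "k \<le> i")
      case True
      then show ?thesis using upper i by simp
    next
      case False
      \<comment> \<open>An index below \<open>k\<close> reflects to one above it, because
        \<open>2 * k < d\<close>.\<close>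
      then have "k \<le> d + 1 - i" "d + 1 - i \<le> d" using i assms by auto
      then have "q dvd m d (d + 1 - i) k" by (rule upper)
      then show ?thesis using m_reflect[of i d k] i by simp
    qed
  qed
qed

lemma G_nonneg: "G d k \<ge> 0"
  by (simp add: G_def)

section \<open>Valuations of binomial coefficients and their common divisors\<close>

lemma multiplicity_choose_prime_power:
  fixes p n :: nat
  assumes "prime p" "n > 0" "p ^ s dvd n"
  shows "multiplicity p (n choose p ^ s) + s = multiplicity p n"
proof -
  obtain t where t: "n = p ^ s * t" using assms(3) by blast
  with assms have "t > 0" by (cases t) auto
  then have "multiplicity p (n choose p ^ s) = multiplicity p t"
    unfolding t using assms(1) by (intro const_p_fac)
  moreover have "multiplicity p n = s + multiplicity p t"
    unfolding t using assms(1) \<open>t > 0\<close>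
    by (subst prime_elem_multiplicity_mult_distrib) auto
  ultimately show ?thesis by simp
qed

text \<open>Absorption: \<open>j * binom(n, j) = n * binom(n - 1, j - 1)\<close>.\<close>

lemma dvd_times_choose: "1 \<le> j \<Longrightarrow> n dvd j * (n choose j)" for n j :: nat
  by (simp add: times_binomial_minus1_eq)

lemma even_choose_upto_iff:
  fixes n r e :: nat
  assumes "n > 0" "2 ^ e \<le> r" "r < 2 ^ (e + 1)"
  shows "(\<forall>j\<in>{1..r}. even (n choose j)) \<longleftrightarrow> 2 ^ (e + 1) dvd n"
proof
  assume *: "\<forall>j\<in>{1..r}. even (n choose j)"
  show "2 ^ (e + 1) dvd n"
  proof (rule ccontr)
    assume "\<not> 2 ^ (e + 1) dvd n"
    \<comment> \<open>The witness is \<open>j = 2 ^ s\<close>, the exact power of 2 in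
      \<open>n\<close>, for which the binomial is odd.\<close>
    define s where "s = multiplicity 2 n"
    have "s < e + 1"
      using \<open>\<not> 2 ^ (e + 1) dvd n\<close> multiplicity_dvd'[of "e + 1" 2 n] by (force simp: s_def)
    then have "(2::nat) ^ s \<le> 2 ^ e" by simp
    then have "2 ^ s \<le> r" using assms(2) by linarith
    then have "2 ^ s \<in> {1..r}" by simp
    then have "even (n choose 2 ^ s)" using * by blast
    moreover have dvd: "2 ^ s dvd n" by (simp add: s_def multiplicity_dvd)
    then have "multiplicity 2 (n choose 2 ^ s) = 0"
      using multiplicity_choose_prime_power[of 2 n s] assms(1) by (simp add: s_def)
    moreover have "n choose 2 ^ s \<noteq> 0"
      using dvd_imp_le[OF dvd assms(1)] by simp
    ultimately show False by (simp add: multiplicity_eq_zero_iff)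
  qed
next
  assume *: "2 ^ (e + 1) dvd n"
  show "\<forall>j\<in>{1..r}. even (n choose j)"
  proof
    fix j assume j: "j \<in> {1..r}"
    have "2 ^ (e + 1) dvd j * (n choose j)"
      using * dvd_times_choose[of j n] j by (auto intro: dvd_trans)
    show "even (n choose j)"
    proof (rule ccontr)
      assume "odd (n choose j)"
      then have "coprime (2 ^ (e + 1)) (n choose j)" by simp
      then have "2 ^ (e + 1) dvd j"
        using \<open>2 ^ (e + 1) dvd j * (n choose j)\<close> by (simp only: coprime_dvd_mult_left_iff)
      then show False using j assms(3) by (auto dest: dvd_imp_le)
    qed
  qed
qed

lemma multiplicity_prod_prime_powers_upto:
  fixes r p :: nat and e :: "nat \<Rightarrow> nat"
  assumes "prime p"
  shows "multiplicity p (\<Prod>q | prime q \<and> q \<le> r. q ^ e q) = (if p \<le> r then e p else 0)"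
proof -
  have "finite {q. prime q \<and> q \<le> r}" by simp
  then have "multiplicity p (\<Prod>q | prime q \<and> q \<le> r. q ^ e q)
      = (\<Sum>q | prime q \<and> q \<le> r. multiplicity p (q ^ e q))"
    using assms by (intro prime_elem_multiplicity_prod_distrib) auto
  also have "\<dots> = (\<Sum>q | prime q \<and> q \<le> r. if q = p then e p else 0)"
    using assms by (intro sum.cong refl) (auto simp: multiplicity_distinct_prime_power)
  also have "\<dots> = (if p \<le> r then e p else 0)"
    using assms by simp
  finally show ?thesis .
qed

context
  fixes n r L :: nat and e :: "nat \<Rightarrow> nat"
  assumes n: "n > 0"
    and e: "\<And>p. prime p \<Longrightarrow> p \<le> r \<Longrightarrow> p ^ e p \<le> r \<and> r < p ^ (e p + 1)"
  defines "L \<equiv> \<Prod>p | prime p \<and> p \<le> r. p ^ e p"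
begin

lemma prod_prime_powers_pos: "L > 0"
  unfolding L_def by (intro prod_pos) (auto simp: prime_gt_0_nat)

text \<open>Prime by prime, \<open>p ^ v \<le> r < p ^ (e p + 1)\<close> forces
  \<open>v \<le> e p\<close>. In fact \<open>L\<close> is the least common multiple of
  \<open>1, ..., r\<close>.\<close>

lemma dvd_prod_prime_powers:
  assumes "1 \<le> j" "j \<le> r"
  shows "j dvd L"
proof (rule multiplicity_le_imp_dvd)
  fix p :: nat assume p: "prime p"
  define v where "v = multiplicity p j"
  have "p ^ v dvd j" by (simp add: v_def multiplicity_dvd)
  then have le: "p ^ v \<le> r" using assms by (auto dest: dvd_imp_le)
  show "multiplicity p j \<le> multiplicity p L"
  proof (cases "v = 0")
    case False
    then have "p \<le> p ^ v" using p by (intro self_le_power) (auto simp: prime_ge_Suc_0_nat)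
    then have "p \<le> r" using le by simp
    then have "p ^ v < p ^ (e p + 1)" using e[OF p] le by linarith
    then have "v < e p + 1" using p prime_gt_1_nat power_less_imp_less_exp by blast
    then show ?thesis
      using multiplicity_prod_prime_powers_upto[OF p] \<open>p \<le> r\<close> by (simp add: L_def v_def)
  qed (simp add: v_def)
qed (use assms in simp)

text \<open>Forwards, \<open>n\<close> divides both \<open>n * binom(n, j)\<close> and
  \<open>L * binom(n, j)\<close>, hence \<open>gcd n L * binom(n, j)\<close>. Backwards, for each
  prime \<open>p\<close> the index \<open>j = p ^ s\<close> with \<open>s\<close> the valuation of
  \<open>gcd n L\<close> bounds the valuation of \<open>q\<close>.\<close>

lemma dvd_all_choose_iff:
  "q dvd n div gcd n L \<longleftrightarrow> (\<forall>j\<in>{1..r}. q dvd n choose j)" if "r \<ge> 1"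
proof
  assume q: "q dvd n div gcd n L"
  show "\<forall>j\<in>{1..r}. q dvd n choose j"
  proof
    fix j assume j: "j \<in> {1..r}"
    have "n dvd j * (n choose j)" using j dvd_times_choose by simp
    also have "j * (n choose j) dvd L * (n choose j)"
      using dvd_prod_prime_powers j by (simp add: mult_dvd_mono)
    finally have "n dvd gcd (n * (n choose j)) (L * (n choose j))" by simp
    then have "n dvd gcd n L * (n choose j)" by (simp add: gcd_mult_distrib_nat mult.commute)
    then have "n div gcd n L dvd n choose j" using n by (simp add: div_dvd_iff_mult mult.commute)
    then show "q dvd n choose j" using q dvd_trans by blast
  qed
next
  assume q: "\<forall>j\<in>{1..r}. q dvd n choose j"
  then have "q dvd n" using that by force
  then have "q > 0" using n by (auto intro: Nat.gr0I)
  have "q * gcd n L dvd n"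
  proof (rule multiplicity_le_imp_dvd)
    show "q * gcd n L \<noteq> 0" using \<open>q > 0\<close> n by simp
    fix p :: nat assume p: "prime p"
    define s where "s = multiplicity p (gcd n L)"
    have "s \<le> multiplicity p L"
      unfolding s_def using prod_prime_powers_pos by (intro dvd_imp_multiplicity_le) auto
    then have s: "s \<le> (if p \<le> r then e p else 0)"
      using multiplicity_prod_prime_powers_upto[OF p] by (simp add: L_def)
    \<comment> \<open>A prime above \<open>r\<close> has \<open>s = 0\<close>, so the index is then
      \<open>j = 1\<close>.\<close>
    have "p ^ s \<le> r"
    proof (cases "p \<le> r")
      case True
      then have "p ^ s \<le> p ^ e p"
        using s p by (intro power_increasing) (auto simp: prime_ge_Suc_0_nat)
      then show ?thesis using e[OF p True] by simp
    qed (use s that in simp)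
    moreover have "p ^ s \<ge> 1" using p by (simp add: prime_gt_0_nat Suc_leI)
    ultimately have "q dvd n choose p ^ s" using q by simp
    have "p ^ s dvd gcd n L" unfolding s_def by (rule multiplicity_dvd)
    then have "p ^ s dvd n" by simp
    then have "n choose p ^ s \<noteq> 0" using dvd_imp_le[of "p ^ s" n] n by simp
    then have "multiplicity p q \<le> multiplicity p (n choose p ^ s)"
      using \<open>q dvd n choose p ^ s\<close> by (intro dvd_imp_multiplicity_le)
    moreover have "multiplicity p (q * gcd n L) = multiplicity p q + s"
      unfolding s_def using p \<open>q > 0\<close> n by (subst prime_elem_multiplicity_mult_distrib) auto
    ultimately show "multiplicity p (q * gcd n L) \<le> multiplicity p n"
      using multiplicity_choose_prime_power[OF p n \<open>p ^ s dvd n\<close>] by simp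
  qed
  then show "q dvd n div gcd n L"
    using n by (simp add: dvd_div_iff_mult)
qed

end

section \<open>The three cases of the gcd formula\<close>

text \<open>The single index \<open>i = d - k\<close> gives
  \<open>binom(k + 1, k + 1) - binom(d - k, k + 1) = 1 - 0\<close>.\<close>

lemma G_eq_1_large:
  assumes "d \<ge> 2" and "k \<le> d - 1" and "k \<ge> (d + 1) div 2"
  shows "G d k = 1"
proof -
  have "d - k \<in> {1..d div 2}" using assms by auto
  then have "G d k dvd m d (d - k) k" unfolding G_def by (intro Gcd_dvd imageI)
  moreover have "m d (d - k) k = 1"
  proof -
    have "d + 1 - (d - k) = k + 1" "d - k < k + 1" using assms by auto
    then show ?thesis by (simp add: m_def)
  qed
  ultimately show ?thesis using G_nonneg[of d k] by simp
qed

text \<open>Here \<open>k + 1\<close> is odd, so the sign condition becomes \<open>q dvd 2\<close>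
  and only the parity of the binomials remains to be decided.\<close>

lemma G_even:
  assumes "d \<ge> 2" and k: "k < (d + 1) div 2" and "even k"
    and e: "2 ^ e \<le> k + 1" "k + 1 < 2 ^ (e + 1)"
  shows "G d k = (if [int d - int k + 1 = 0] (mod 2 ^ (e + 1)) then 2 else 1)"
proof -
  have D: "int d - int k + 1 = int (d + 1 - k)" "d + 1 - k > 0" using k by auto
  have *: "q dvd G d k \<longleftrightarrow> q dvd 2 \<and> (\<forall>j\<in>{1..k + 1}. q dvd int ((d + 1 - k) choose j))" for q
    using dvd_G_iff[OF assms(1,2)] \<open>even k\<close> by simp
  have "G d k dvd 2" using *[of "G d k"] by simp
  then have "G d k \<le> 2" "G d k \<noteq> 0" by (auto dest: zdvd_imp_le)
  then have G12: "G d k = 1 \<or> G d k = 2" using G_nonneg[of d k] by linarith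
  have "2 dvd G d k \<longleftrightarrow> (\<forall>j\<in>{1..k + 1}. even ((d + 1 - k) choose j))"
    unfolding * by simp
  also have "\<dots> \<longleftrightarrow> 2 ^ (e + 1) dvd d + 1 - k"
    using even_choose_upto_iff[OF D(2) e] .
  also have "\<dots> \<longleftrightarrow> int (2 ^ (e + 1)) dvd int (d + 1 - k)"
    by (simp only: int_dvd_int_iff)
  also have "\<dots> \<longleftrightarrow> [int d - int k + 1 = 0] (mod 2 ^ (e + 1))"
    unfolding D(1) cong_0_iff by simp
  finally show ?thesis using G12 by auto
qed

text \<open>Here \<open>k + 1\<close> is even, so the sign condition is vacuous; two nonnegative
  numbers with the same divisors are equal.\<close>

lemma G_odd:
  fixes e :: "nat \<Rightarrow> nat"
  assumes "d \<ge> 2" and k: "k < (d + 1) div 2" and "odd k"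
    and e: "\<And>p. prime p \<Longrightarrow> p \<le> k + 1 \<Longrightarrow> p ^ e p \<le> k + 1 \<and> k + 1 < p ^ (e p + 1)"
  shows "G d k = (int d - int k + 1) div
    gcd (int d - int k + 1) (int (\<Prod>p | prime p \<and> p \<le> k + 1. p ^ e p))"
proof -
  define D where "D = d + 1 - k"
  define L where "L = (\<Prod>p | prime p \<and> p \<le> k + 1. p ^ e p)"
  have D: "int d - int k + 1 = int D" "D > 0" using k by (auto simp: D_def)
  have *: "int q dvd G d k \<longleftrightarrow> q dvd D div gcd D L" for q
  proof -
    have "int q dvd G d k \<longleftrightarrow> (\<forall>j\<in>{1..k + 1}. q dvd D choose j)"
      using dvd_G_iff[OF assms(1,2)] \<open>odd k\<close> by (simp add: D_def)
    also have "\<dots> \<longleftrightarrow> q dvd D div gcd D L"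
      unfolding L_def using dvd_all_choose_iff[OF D(2) e] by simp
    finally show ?thesis .
  qed
  have "nat (G d k) = D div gcd D L"
    using *[of "nat (G d k)"] *[of "D div gcd D L"] G_nonneg[of d k]
    by (intro dvd_antisym) (auto simp flip: int_dvd_int_iff)
  then have "G d k = int (D div gcd D L)" using G_nonneg[of d k] by linarith
  then show ?thesis unfolding D(1) L_def[symmetric] by (simp add: zdiv_int)
qed

theorem theorem3p1:
  fixes d k :: nat
  assumes "d \<ge> 2" and "k \<le> d - 1"
  shows
    "(k \<ge> (d + 1) div 2 \<longrightarrow> G d k = 1) \<and>
     (k < (d + 1) div 2 \<and> even k \<longrightarrow>
        (\<forall>e::nat. 2 ^ e \<le> k + 1 \<and> k + 1 < 2 ^ (e + 1) \<longrightarrow>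
           G d k = (if [int d - int k + 1 = 0] (mod 2 ^ (e + 1)) then 2 else 1))) \<and>
     (k < (d + 1) div 2 \<and> odd k \<longrightarrow>
        (\<forall>e::nat \<Rightarrow> nat.
           (\<forall>p. prime p \<and> p \<le> k + 1 \<longrightarrow>
              e p \<ge> 1 \<and> p ^ e p \<le> k + 1 \<and> k + 1 < p ^ (e p + 1)) \<longrightarrow>
           G d k = (int d - int k + 1) div
             gcd (int d - int k + 1) (int (\<Prod>p | prime p \<and> p \<le> k + 1. p ^ e p))))"
  using G_eq_1_large[OF assms] G_even[OF assms(1)] G_odd[OF assms(1)] by blast

end
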